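(* Let $T>0$, $b<0$, let $\varphi:\mathbb{R}\to\mathbb{R}$ be a homeomorphism with $\varphi(0)=0$, and let $f:[0,T]\times\mathbb{R}\times\mathbb{R}\to\mathbb{R}$ be continuous. If there exists a continuous function $h:[0,T]\to\mathbb{R}$ such that $$|f(t,x,y)|\le h(t)\quad\text{for all }(t,x,y)\in[0,T]\times\mathbb{R}^2,$$ then the problem $$(\varphi(u'))'=f(t,u,u'),\quad u'(0)=u(0),\quad u'(T)=bu'(0)$$ has a solution.
   Context: A solution is a function $u:[0,T]\to\mathbb{R}$ of class $C^1$ such that $\varphi(u')$ is continuously differentiable, $(\varphi(u'(t)))'=f(t,u(t),u'(t))$ for all $t\in[0,T]$, and the boundary conditions hold. *)

theory Defs
  imports "HOL-Analysis.Analysis"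
begin

(* One-sided derivatives are meant at the end points; for 0 < T the values of g' on {0..T}
   are determined by g. *)
definition C1_with_derivative :: "real \<Rightarrow> (real \<Rightarrow> real) \<Rightarrow> (real \<Rightarrow> real) \<Rightarrow> bool" where
  "C1_with_derivative T g g' \<longleftrightarrow>
     (\<forall>t\<in>{0..T}. (g has_real_derivative g' t) (at t within {0..T})) \<and>
     continuous_on {0..T} g'"

(* u' stands for the derivative of u and w for that of phi(u'); only values on {0..T} matter. *)
definition is_solution ::
  "real \<Rightarrow> real \<Rightarrow> (real \<Rightarrow> real) \<Rightarrow> (real \<Rightarrow> real \<Rightarrow> real \<Rightarrow> real) \<Rightarrow> (real \<Rightarrow> real) \<Rightarrow> bool" where
  "is_solution T b \<phi> f u \<longleftrightarrow>
     (\<exists>u' w. C1_with_derivative T u u' \<and>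
             C1_with_derivative T (\<lambda>t. \<phi> (u' t)) w \<and>
             (\<forall>t\<in>{0..T}. w t = f t (u t) (u' t)) \<and>
             u' 0 = u 0 \<and> u' T = b * u' 0)"

end

(* With z = phi(u') and psi the inverse of phi, the equation is the system u' = psi(z),
   z' = f(t, u, psi(z)). Its Euler scheme started at (a, phi(a)) depends continuously on a.
   Since f is bounded, the final z differs from phi(a) by a bounded amount, while phi(b a)
   and phi(a) have opposite signs because b < 0; hence the intermediate value theorem provides,
   for each step size, an a in a fixed compact interval such that the final z equals phi(b a).
   By the theorem of Arzela and Ascoli a subsequence of the Euler polygons converges uniformly,
   and the limit solves the boundary value problem. *)

theory Submission
  imports Defs "HOL-Complex_Analysis.Great_Picard"
begin

section \<open>Euler polygons\<close>

text \<open>\<open>overlap \<tau> k t\<close> is the length of \<open>{0..t} \<inter> {k\<tau>..(k + 1)\<tau>}\<close>.\<close>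

definition overlap :: "real \<Rightarrow> nat \<Rightarrow> real \<Rightarrow> real" where
  "overlap \<tau> k t = max 0 (min \<tau> (t - real k * \<tau>))"

primrec euler :: "(real \<Rightarrow> 'a \<Rightarrow> 'a) \<Rightarrow> real \<Rightarrow> 'a \<Rightarrow> nat \<Rightarrow> 'a::real_vector" where
  "euler G \<tau> x 0 = x"
| "euler G \<tau> x (Suc k) = euler G \<tau> x k + \<tau> *\<^sub>R G (real k * \<tau>) (euler G \<tau> x k)"

text \<open>Weighting every slope by \<open>overlap\<close> gives the piecewise linear interpolant
  without singling out the step that contains \<open>t\<close>; an increment is then a sum of slopes
  weighted by differences of overlaps.\<close>

definition euler_polygon :: "(real \<Rightarrow> 'a \<Rightarrow> 'a) \<Rightarrow> real \<Rightarrow> nat \<Rightarrow> 'a \<Rightarrow> real \<Rightarrow> 'a::real_vector" where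
  "euler_polygon G \<tau> n x t = x + (\<Sum>k<n. overlap \<tau> k t *\<^sub>R G (real k * \<tau>) (euler G \<tau> x k))"

text \<open>The steps tile \<open>{0..n * \<tau>}\<close>. This makes the weights in an increment
  from \<open>s\<close> to \<open>t\<close> add up to \<open>t - s\<close>.\<close>

lemma sum_overlap:
  assumes "\<tau> \<ge> 0"
  shows "(\<Sum>k<n. overlap \<tau> k t) = max 0 (min t (real n * \<tau>))"
proof (induction n)
  case 0
  then show ?case by simp
next
  case (Suc n)
  define y where "y = real n * \<tau>"
  have "y \<ge> 0" "real (Suc n) * \<tau> = y + \<tau>" using assms by (simp_all add: y_def algebra_simps)
  with Suc assms show ?case
    by (simp add: overlap_def flip: y_def)
qed

lemma overlap_mono: "s \<le> t \<Longrightarrow> overlap \<tau> k s \<le> overlap \<tau> k t"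
  by (auto simp: overlap_def)

text \<open>Steps that do not meet the open interval between \<open>s\<close> and \<open>t\<close>
  get weight zero in the increment.\<close>

lemma overlap_eq:
  assumes "\<tau> \<ge> 0" "s \<le> t" "t \<le> real k * \<tau> \<or> real (Suc k) * \<tau> \<le> s"
  shows "overlap \<tau> k s = overlap \<tau> k t"
  using assms by (auto simp: overlap_def algebra_simps)

lemma euler_eq_sum:
  "euler G \<tau> x n = x + \<tau> *\<^sub>R (\<Sum>k<n. G (real k * \<tau>) (euler G \<tau> x k))"
  by (induction n) (simp_all add: scaleR_add_right)

text \<open>At node \<open>j\<close> the first \<open>j\<close> overlaps are full and all later ones
  vanish, which leaves the closed form of the scheme.\<close>

lemma euler_polygon_node:
  assumes "\<tau> \<ge> 0" "j \<le> n"
  shows "euler_polygon G \<tau> n x (real j * \<tau>) = euler G \<tau> x j"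
proof -
  let ?c = "\<lambda>k. G (real k * \<tau>) (euler G \<tau> x k)"
  have full: "overlap \<tau> k (real j * \<tau>) = \<tau>" if "k < j" for k
  proof -
    have "real (Suc k) * \<tau> \<le> real j * \<tau>"
      using that assms(1) by (intro mult_right_mono) auto
    then show ?thesis using assms(1) by (simp add: overlap_def algebra_simps)
  qed
  have none: "overlap \<tau> k (real j * \<tau>) = 0" if "\<not> k < j" for k
  proof -
    have "real j * \<tau> \<le> real k * \<tau>"
      using that assms(1) by (intro mult_right_mono) auto
    then show ?thesis using assms(1) by (simp add: overlap_def)
  qed
  have "(\<Sum>k<n. overlap \<tau> k (real j * \<tau>) *\<^sub>R ?c k) = (\<Sum>k<j. \<tau> *\<^sub>R ?c k)"
    using assms(2) by (intro sum.mono_neutral_cong_right) (auto simp: full none)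
  then show ?thesis
    by (simp add: euler_polygon_def euler_eq_sum[of G \<tau> x j] scaleR_sum_right)
qed

text \<open>The increment is a combination of node slopes with nonnegative weights of total
  \<open>t - s\<close>. If all slopes that carry weight are \<open>\<epsilon>\<close>-close to
  \<open>L\<close>, so is their average.\<close>

lemma euler_polygon_increment_ordered:
  fixes G :: "real \<Rightarrow> 'a \<Rightarrow> 'a::real_normed_vector"
  assumes \<tau>: "\<tau> \<ge> 0" and st: "0 \<le> s" "s \<le> t" "t \<le> real n * \<tau>"
    and near: "\<And>k. \<lbrakk>k < n; real k * \<tau> < t; s < real (Suc k) * \<tau>\<rbrakk>
      \<Longrightarrow> norm (G (real k * \<tau>) (euler G \<tau> x k) - L) \<le> \<epsilon>"
  shows "norm (euler_polygon G \<tau> n x t - euler_polygon G \<tau> n x s - (t - s) *\<^sub>R L) \<le> \<epsilon> * (t - s)"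
proof -
  let ?c = "\<lambda>k. G (real k * \<tau>) (euler G \<tau> x k)"
  let ?w = "\<lambda>k. overlap \<tau> k t - overlap \<tau> k s"
  have w: "(\<Sum>k<n. ?w k) = t - s"
    using \<tau> st by (simp add: sum_subtractf sum_overlap)
  have "euler_polygon G \<tau> n x t - euler_polygon G \<tau> n x s - (t - s) *\<^sub>R L = (\<Sum>k<n. ?w k *\<^sub>R (?c k - L))"
    unfolding euler_polygon_def
    by (simp add: scaleR_diff_left scaleR_diff_right sum_subtractf flip: w scaleR_sum_left)
  also have "norm \<dots> \<le> (\<Sum>k<n. \<epsilon> * ?w k)"
  proof (rule sum_norm_le)
    fix k assume "k \<in> {..<n}"
    show "norm (?w k *\<^sub>R (?c k - L)) \<le> \<epsilon> * ?w k"
    proof (cases "real k * \<tau> < t \<and> s < real (Suc k) * \<tau>")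
      case True
      then have "norm (?c k - L) \<le> \<epsilon>" using near \<open>k \<in> {..<n}\<close> by simp
      then show ?thesis
        using overlap_mono[OF st(2), of \<tau> k] by (simp add: mult.commute[of \<epsilon>] mult_left_mono del: of_nat_Suc)
    next
      case False
      then show ?thesis using overlap_eq[OF \<tau> st(2), of k] by auto
    qed
  qed
  also have "\<dots> = \<epsilon> * (t - s)" by (simp only: w flip: sum_distrib_left)
  finally show ?thesis .
qed

lemma euler_polygon_increment:
  fixes G :: "real \<Rightarrow> 'a \<Rightarrow> 'a::real_normed_vector"
  assumes \<tau>: "\<tau> \<ge> 0" and st: "s \<in> {0..real n * \<tau>}" "t \<in> {0..real n * \<tau>}"
    and near: "\<And>k. \<lbrakk>k < n; real k * \<tau> < max s t; min s t < real (Suc k) * \<tau>\<rbrakk>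
      \<Longrightarrow> norm (G (real k * \<tau>) (euler G \<tau> x k) - L) \<le> \<epsilon>"
  shows "norm (euler_polygon G \<tau> n x t - euler_polygon G \<tau> n x s - (t - s) *\<^sub>R L) \<le> \<epsilon> * \<bar>t - s\<bar>"
proof (cases "s \<le> t")
  case True
  have "norm (euler_polygon G \<tau> n x t - euler_polygon G \<tau> n x s - (t - s) *\<^sub>R L) \<le> \<epsilon> * (t - s)"
    using True near by (intro euler_polygon_increment_ordered \<tau>) (use st in auto)
  with True show ?thesis by simp
next
  case False
  have "norm (euler_polygon G \<tau> n x s - euler_polygon G \<tau> n x t - (s - t) *\<^sub>R L) \<le> \<epsilon> * (s - t)"
    using False near by (intro euler_polygon_increment_ordered \<tau>) (use st in auto)
  moreover have "euler_polygon G \<tau> n x t - euler_polygon G \<tau> n x s - (t - s) *\<^sub>R L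
      = - (euler_polygon G \<tau> n x s - euler_polygon G \<tau> n x t - (s - t) *\<^sub>R L)"
    by (simp add: algebra_simps)
  ultimately show ?thesis using False by (simp only: norm_minus_cancel) simp
qed

text \<open>The increment estimate with \<open>L = 0\<close> and
  \<open>\<epsilon> = B\<close>.\<close>

lemma euler_polygon_lipschitz:
  fixes G :: "real \<Rightarrow> 'a \<Rightarrow> 'a::real_normed_vector"
  assumes "\<tau> \<ge> 0" "s \<in> {0..real n * \<tau>}" "t \<in> {0..real n * \<tau>}"
    and "\<And>t y. norm (G t y) \<le> B"
  shows "norm (euler_polygon G \<tau> n x t - euler_polygon G \<tau> n x s) \<le> B * \<bar>t - s\<bar>"
  using euler_polygon_increment[OF assms(1-3), of G x 0 B] assms(4) by simp

text \<open>Continuous dependence on the initial value is what shooting requires of the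
  scheme.\<close>

lemma continuous_on_euler:
  fixes G :: "real \<Rightarrow> 'a \<Rightarrow> 'a::real_normed_vector"
  assumes "continuous_on UNIV (\<lambda>(t, y). G t y)"
  shows "continuous_on UNIV (\<lambda>x. euler G \<tau> x n)"
proof (induction n)
  case 0
  then show ?case by (simp add: continuous_on_id)
next
  case (Suc n)
  have "continuous_on UNIV (\<lambda>x. (\<lambda>(t, y). G t y) (real n * \<tau>, euler G \<tau> x n))"
    by (rule continuous_on_compose2[OF assms])
      (use Suc in \<open>auto intro!: continuous_intros\<close>)
  with Suc show ?case by (auto intro!: continuous_intros)
qed

section \<open>Passage to the limit\<close>

text \<open>The polygons share the Lipschitz constant \<open>B\<close> and the bound
  \<open>C + B * T\<close>, so Arzela-Ascoli applies. The start may vary with \<open>n\<close>, as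
  shooting demands, and convergence at both ends carries the boundary conditions to the
  limit.\<close>

theorem euler_subsequence_limit:
  fixes G :: "real \<Rightarrow> 'a \<Rightarrow> 'a::euclidean_space" and x0 :: "nat \<Rightarrow> 'a"
  assumes T: "T > 0" and cont: "continuous_on UNIV (\<lambda>(t, y). G t y)"
    and B: "\<And>t y. norm (G t y) \<le> B" and C: "\<And>n. norm (x0 n) \<le> C"
  obtains x and r :: "nat \<Rightarrow> nat" where
    "\<And>t. t \<in> {0..T} \<Longrightarrow> (x has_vector_derivative G t (x t)) (at t within {0..T})"
    "strict_mono r" "(\<lambda>n. x0 (r n)) \<longlonglongrightarrow> x 0"
    "(\<lambda>n. euler G (T / real (Suc (r n))) (x0 (r n)) (Suc (r n))) \<longlonglongrightarrow> x T"
proof -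
  \<comment> \<open>Taking \<open>Suc n\<close> steps avoids a division by zero at
    \<open>n = 0\<close>.\<close>
  define \<tau> where "\<tau> n = T / real (Suc n)" for n
  define p where "p n = euler_polygon G (\<tau> n) (Suc n) (x0 n)" for n
  have \<tau>: "\<tau> n \<ge> 0" "real (Suc n) * \<tau> n = T" for n
    using T by (simp_all add: \<tau>_def del: of_nat_Suc)
  have node: "p n (real j * \<tau> n) = euler G (\<tau> n) (x0 n) j" if "j \<le> Suc n" for n j
    unfolding p_def using euler_polygon_node \<tau>(1) that by blast
  have p0: "p n 0 = x0 n" for n
    using node[of 0 n] by simp
  have pT: "p n T = euler G (\<tau> n) (x0 n) (Suc n)" for n
    using node[of "Suc n" n] \<tau>(2) by simp
  have lip: "norm (p n t - p n s) \<le> B * \<bar>t - s\<bar>" if "s \<in> {0..T}" "t \<in> {0..T}" for n s t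
    unfolding p_def by (rule euler_polygon_lipschitz) (use that \<tau> B in simp_all)
  have B0: "B \<ge> 0"
    by (rule order_trans[OF norm_ge_zero B[of 0 0]])
  obtain x and r :: "nat \<Rightarrow> nat" where x: "continuous_on {0..T} x" and r: "strict_mono r"
    and lim: "\<And>e. 0 < e \<Longrightarrow> \<exists>N. \<forall>n t. n \<ge> N \<and> t \<in> {0..T} \<longrightarrow> norm (p (r n) t - x t) < e"
  proof (rule Arzela_Ascoli[of "{0..T}" p "C + B * T"])
    show "norm (p n t) \<le> C + B * T" if "t \<in> {0..T}" for n t
    proof -
      have "norm (p n t - p n 0) \<le> B * \<bar>t - 0\<bar>" by (rule lip) (use that in auto)
      also have "\<dots> \<le> B * T" using that B0 by (intro mult_left_mono) auto
      finally have "norm (p n t - p n 0) \<le> B * T" .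
      moreover have "norm (p n t) \<le> norm (p n 0) + norm (p n t - p n 0)"
        by (rule norm_triangle_sub)
      ultimately show ?thesis using C[of n] by (simp add: p0)
    qed
    show "\<exists>d>0. \<forall>n s. s \<in> {0..T} \<and> norm (t - s) < d \<longrightarrow> norm (p n t - p n s) < e"
      if "t \<in> {0..T}" "0 < e" for t e
    \<comment> \<open>The \<open>+ 1\<close> covers the case \<open>B = 0\<close> and makes the
      final inequality strict.\<close>
    proof (intro exI[of _ "e / (B + 1)"] conjI allI impI)
      show "0 < e / (B + 1)" using that B0 by simp
      fix n s assume s: "s \<in> {0..T} \<and> norm (t - s) < e / (B + 1)"
      have "norm (p n t - p n s) \<le> B * \<bar>t - s\<bar>" using lip s that by blast
      also have "\<dots> \<le> B * (e / (B + 1))" using s B0 by (intro mult_left_mono) auto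
      also have "\<dots> < e" using B0 that by (simp add: field_simps)
      finally show "norm (p n t - p n s) < e" .
    qed
  qed (rule compact_Icc, rule that)
  have ptw: "(\<lambda>n. p (r n) t) \<longlonglongrightarrow> x t" if "t \<in> {0..T}" for t
    unfolding LIMSEQ_iff using lim that by meson
  have \<tau>_lim: "(\<lambda>n. \<tau> (r n)) \<longlonglongrightarrow> 0"
  proof -
    have "\<tau> \<longlonglongrightarrow> 0"
      unfolding \<tau>_def using LIMSEQ_Suc[OF lim_const_over_n[of T]] by simp
    then show ?thesis using LIMSEQ_subseq_LIMSEQ[OF _ r] by (auto simp: o_def)
  qed
  \<comment> \<open>For \<open>s\<close> near \<open>t\<close> and large \<open>n\<close>, all
    slopes used between them are \<open>e\<close>-close to \<open>G t (x t)\<close>. The increment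
    estimate holds for the polygons, and its non-strict form survives the limit in
    \<open>n\<close>.\<close>
  have der: "(x has_vector_derivative G t (x t)) (at t within {0..T})" if t: "t \<in> {0..T}" for t
    unfolding has_vector_derivative_def has_derivative_within_alt
  proof (intro conjI allI impI)
    show "bounded_linear (\<lambda>h. h *\<^sub>R G t (x t))" by (rule bounded_linear_scaleR_left)
    fix e :: real assume e: "0 < e"
    have "continuous (at (t, x t)) (\<lambda>(t, y). G t y)"
      using cont by (simp add: continuous_on_eq_continuous_at)
    then obtain \<delta> where \<delta>: "\<delta> > 0"
      "\<And>s y. dist (s, y) (t, x t) < \<delta> \<Longrightarrow> dist (G s y) (G t (x t)) < e"
      unfolding continuous_at_eps_delta using e by (auto simp: split_paired_all)
    obtain \<eta>' where \<eta>': "\<eta>' > 0" "\<And>s. s \<in> {0..T} \<Longrightarrow> dist s t < \<eta>' \<Longrightarrow> dist (x s) (x t) < \<delta> / 3"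
      using x \<delta>(1) t unfolding continuous_on_iff
      by (metis zero_less_divide_iff zero_less_numeral)
    \<comment> \<open>The radius \<open>\<delta>\<close> is split in three: the time distance, the
      distance from polygon to limit, and the oscillation of \<open>x\<close>.\<close>
    define \<eta> where "\<eta> = min \<eta>' (\<delta> / 3)"
    have \<eta>: "\<eta> > 0" using \<delta>(1) \<eta>'(1) by (simp add: \<eta>_def)
    show "\<exists>d>0. \<forall>s\<in>{0..T}. norm (s - t) < d \<longrightarrow>
        norm (x s - x t - (s - t) *\<^sub>R G t (x t)) \<le> e * norm (s - t)"
    \<comment> \<open>One half of \<open>\<eta>\<close> is for \<open>s - t\<close>, the other for
      the step size: a slope is taken at the left node of its step, which may precede both
      \<open>s\<close> and \<open>t\<close> by almost one step.\<close>
    proof (intro exI[of _ "\<eta> / 2"] conjI ballI impI)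
      show "0 < \<eta> / 2" using \<eta> by simp
      fix s assume s: "s \<in> {0..T}" "norm (s - t) < \<eta> / 2"
      show "norm (x s - x t - (s - t) *\<^sub>R G t (x t)) \<le> e * norm (s - t)"
      proof (rule tendsto_upperbound)
        show "(\<lambda>n. norm (p (r n) s - p (r n) t - (s - t) *\<^sub>R G t (x t)))
            \<longlonglongrightarrow> norm (x s - x t - (s - t) *\<^sub>R G t (x t))"
          by (intro tendsto_intros ptw s t)
        have "\<forall>\<^sub>F n in sequentially. \<tau> (r n) < \<eta> / 2"
          using \<eta> by (intro order_tendstoD(2)[OF \<tau>_lim]) simp
        moreover have "\<forall>\<^sub>F n in sequentially. \<forall>q\<in>{0..T}. norm (p (r n) q - x q) < \<delta> / 3"
          using lim[of "\<delta> / 3"] \<delta>(1) unfolding eventually_sequentially by (metis zero_less_divide_iff zero_less_numeral)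
        ultimately show "\<forall>\<^sub>F n in sequentially.
            norm (p (r n) s - p (r n) t - (s - t) *\<^sub>R G t (x t)) \<le> e * norm (s - t)"
        proof eventually_elim
          case (elim n)
          let ?m = "r n"
          have "norm (p ?m s - p ?m t - (s - t) *\<^sub>R G t (x t)) \<le> e * \<bar>s - t\<bar>"
            unfolding p_def
          proof (rule euler_polygon_increment)
            fix k assume k: "k < Suc ?m" "real k * \<tau> ?m < max t s" "min t s < real (Suc k) * \<tau> ?m"
            define q where "q = real k * \<tau> ?m"
            have "q \<le> real (Suc ?m) * \<tau> ?m"
              unfolding q_def using k(1) \<tau>(1) by (intro mult_right_mono) auto
            then have q: "q \<in> {0..T}"
              using \<tau>(1)[of ?m] unfolding \<tau>(2) by (simp add: q_def)
            have "min t s < q + \<tau> ?m" using k(3) by (simp add: q_def algebra_simps)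
            then have qt: "\<bar>q - t\<bar> < \<eta>"
              using k(2) s(2) elim(1)
              by (auto simp: min_def max_def abs_less_iff simp flip: q_def split: if_splits)
            have "dist (p ?m q) (x t) \<le> dist (p ?m q) (x q) + dist (x q) (x t)"
              by (rule dist_triangle)
            also have "\<dots> < \<delta> / 3 + \<delta> / 3"
              using elim(2) q \<eta>'(2)[OF q] qt by (intro add_strict_mono) (auto simp: dist_norm \<eta>_def)
            finally have "dist (p ?m q) (x t) < \<delta> / 3 + \<delta> / 3" .
            moreover have "dist (q, p ?m q) (t, x t) \<le> dist q t + dist (p ?m q) (x t)"
              by (simp add: dist_prod_def sqrt_sum_squares_le_sum)
            ultimately have "dist (q, p ?m q) (t, x t) < \<delta>"
              using qt by (simp add: \<eta>_def dist_norm)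
            from \<delta>(2)[OF this] have "norm (G q (p ?m q) - G t (x t)) \<le> e"
              by (simp add: dist_norm)
            then show "norm (G (real k * \<tau> ?m) (euler G (\<tau> ?m) (x0 ?m) k) - G t (x t)) \<le> e"
              using node[of k ?m] k(1) by (simp add: q_def)
          qed (use \<tau> s t in auto)
          then show ?case by simp
        qed
      qed simp
    qed
  qed
  show thesis
  proof
    show "(\<lambda>n. x0 (r n)) \<longlonglongrightarrow> x 0" using ptw[of 0] T by (simp add: p0)
    show "(\<lambda>n. euler G (T / real (Suc (r n))) (x0 (r n)) (Suc (r n))) \<longlonglongrightarrow> x T"
      using ptw[of T] T unfolding pT \<tau>_def by simp
  qed (use der r in auto)
qed

section \<open>Shooting\<close>

text \<open>A continuous injection of the line is strictly monotone, so with
  \<open>\<phi> 0 = 0\<close> it either preserves or reverses signs. The product form treats both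
  cases at once.\<close>

lemma opposite_signs:
  fixes \<phi> :: "real \<Rightarrow> real"
  assumes "continuous_on UNIV \<phi>" "inj \<phi>" "\<phi> 0 = 0" "b < 0"
  shows "\<phi> a * \<phi> (b * a) \<le> 0"
proof -
  consider "strict_mono \<phi>" | "strict_antimono_on UNIV \<phi>"
    using injective_eq_monotone_map[of UNIV \<phi>] assms by auto
  then show ?thesis
  proof cases
    case 1
    then have "x \<le> y \<Longrightarrow> \<phi> x \<le> \<phi> y" for x y by (simp add: strict_mono_less_eq)
    from this[of a 0] this[of 0 a] this[of "b * a" 0] this[of 0 "b * a"] assms(3,4)
    show ?thesis by (cases "a \<ge> 0") (auto simp: mult_le_0_iff zero_le_mult_iff)
  next
    case 2
    then have "x \<le> y \<Longrightarrow> \<phi> y \<le> \<phi> x" for x y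
      by (cases "x = y") (auto simp: monotone_on_def less_imp_le)
    from this[of a 0] this[of 0 a] this[of "b * a" 0] this[of 0 "b * a"] assms(3,4)
    show ?thesis by (cases "a \<ge> 0") (auto simp: mult_le_0_iff zero_le_mult_iff)
  qed
qed

theorem theorem4p6:
  fixes T b :: real
    and \<phi> :: "real \<Rightarrow> real"
    and f :: "real \<Rightarrow> real \<Rightarrow> real \<Rightarrow> real"
  assumes "T > 0" and "b < 0"
    and "\<exists>\<psi>. homeomorphism UNIV UNIV \<phi> \<psi>" and "\<phi> 0 = 0"
    and "continuous_on ({0..T} \<times> UNIV \<times> UNIV) (\<lambda>(t, x, y). f t x y)"
    and "\<exists>h :: real \<Rightarrow> real. continuous_on {0..T} h \<and>
           (\<forall>t\<in>{0..T}. \<forall>x y. \<bar>f t x y\<bar> \<le> h t)"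
  shows "\<exists>u. is_solution T b \<phi> f u"
proof -

  \<comment> \<open>A priori bounds and the truncated system\<close>
  obtain \<psi> where "homeomorphism UNIV UNIV \<phi> \<psi>" using assms(3) by blast
  then have \<psi>: "continuous_on UNIV \<phi>" "continuous_on UNIV \<psi>" "\<And>x. \<psi> (\<phi> x) = x" "\<And>y. \<phi> (\<psi> y) = y"
    by (auto simp: homeomorphism_def)
  have "inj \<phi>" using \<psi>(3) by (metis injI)
  obtain h where h: "continuous_on {0..T} h" "\<And>t x y. t \<in> {0..T} \<Longrightarrow> \<bar>f t x y\<bar> \<le> h t"
    using assms(6) by blast
  have "bounded (h ` {0..T})"
    using h(1) by (intro compact_imp_bounded compact_continuous_image) auto
  then obtain M where M': "\<And>t. t \<in> {0..T} \<Longrightarrow> \<bar>h t\<bar> \<le> M"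
    unfolding bounded_iff by (metis imageI real_norm_def)
  have M: "\<bar>f t x y\<bar> \<le> M" if "t \<in> {0..T}" for t x y
    by (rule order_trans[OF h(2)[OF that] order_trans[OF abs_ge_self M'[OF that]]])
  have M0: "M \<ge> 0" using M[of 0 0 0] assms(1) by simp
  \<comment> \<open>At these two starting values \<open>\<phi>\<close> equals
    \<open>M * T + 1\<close> or its negative, so a change of at most \<open>M * T\<close> cannot
    alter the sign of \<open>z\<close>.\<close>
  define R where "R = max \<bar>\<psi> (M * T + 1)\<bar> \<bar>\<psi> (- (M * T + 1))\<bar>"
  have "bounded (\<phi> ` {-R..R})"
    by (intro compact_imp_bounded compact_continuous_image continuous_on_subset[OF \<psi>(1)]) auto
  \<comment> \<open>\<open>K\<close> bounds the initial \<open>z\<close> over all admissible starts;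
    \<open>K + M * T\<close> then bounds \<open>z\<close> at all times.\<close>
  then obtain K where "\<And>a. a \<in> {-R..R} \<Longrightarrow> \<bar>\<phi> a\<bar> \<le> K"
    unfolding bounded_iff by (metis imageI real_norm_def)
  then have K: "\<bar>\<phi> a\<bar> \<le> K" if "\<bar>a\<bar> \<le> R" for a
    using that by (simp add: abs_le_iff)
  have K0: "K \<ge> 0" using K[of 0] by (simp add: R_def assms(4))

  text \<open>Clamping the time to \<open>{0..T}\<close> and \<open>z = \<phi> u'\<close> to an interval that no relevant
    solution leaves makes the first-order system globally continuous and bounded.\<close>
  define cz where "cz z = max (- (K + M * T)) (min z (K + M * T))" for z
  define ct where "ct t = max 0 (min t T)" for t
  define G where "G t q = (\<psi> (cz (snd q)), f (ct t) (fst q) (\<psi> (cz (snd q))))" for t :: real and q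
  have ct: "ct t \<in> {0..T}" for t using assms(1) by (auto simp: ct_def)
  have czc: "continuous_on S cz" and ctc: "continuous_on S ct" for S
    unfolding cz_def ct_def by (intro continuous_intros)+
  have c1: "continuous_on UNIV (\<lambda>w::real \<times> real \<times> real. \<psi> (cz (snd (snd w))))"
    by (intro continuous_on_compose2[OF \<psi>(2)] continuous_on_compose2[OF czc[of UNIV]] continuous_intros) auto
  have c2: "continuous_on UNIV (\<lambda>w::real \<times> real \<times> real. (\<lambda>(t, x, y). f t x y)
      (ct (fst w), fst (snd w), \<psi> (cz (snd (snd w)))))"
    by (intro continuous_on_compose2[OF assms(5)] continuous_on_Pair c1
        continuous_on_compose2[OF ctc[of UNIV]] continuous_intros) (auto simp: ct[simplified])
  have Gc: "continuous_on UNIV (\<lambda>(t, q). G t q)"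
    using continuous_on_Pair[OF c1 c2] by (simp add: G_def case_prod_unfold)
  have "bounded (\<psi> ` {- (K + M * T)..K + M * T})"
    by (intro compact_imp_bounded compact_continuous_image continuous_on_subset[OF \<psi>(2)]) auto
  then obtain L where "\<forall>y \<in> \<psi> ` {- (K + M * T)..K + M * T}. \<bar>y\<bar> \<le> L"
    by (auto simp only: bounded_real)
  then have L: "\<And>z. z \<in> {- (K + M * T)..K + M * T} \<Longrightarrow> \<bar>\<psi> z\<bar> \<le> L"
    by blast
  have cz_in: "cz z \<in> {- (K + M * T)..K + M * T}" for z
    using K0 M0 assms(1) by (auto simp: cz_def)
  have GB: "norm (G t q) \<le> L + M" for t q
  proof -
    have "norm (G t q) \<le> \<bar>\<psi> (cz (snd q))\<bar> + \<bar>f (ct t) (fst q) (\<psi> (cz (snd q)))\<bar>"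
      by (simp add: G_def norm_Pair sqrt_sum_squares_le_sum_abs[THEN order_trans])
    then show ?thesis
      by (rule order_trans) (intro add_mono L M cz_in ct)
  qed

  \<comment> \<open>Solvability of the discrete boundary value problem\<close>
  define X where "X a = (a, \<phi> a)" for a
  \<comment> \<open>Starting from \<open>X a\<close> builds in the condition
    \<open>u'(0) = u(0)\<close>, since \<open>z = \<phi>(u')\<close>.\<close>
  define E where "E n a = euler G (T / real (Suc n)) (X a) (Suc n)" for n a
  have E_snd: "\<bar>snd (E n a) - \<phi> a\<bar> \<le> M * T" for n a
  proof -
    define \<tau> where "\<tau> = T / real (Suc n)"
    have "snd (E n a) - \<phi> a = \<tau> * (\<Sum>k<Suc n. snd (G (real k * \<tau>) (euler G \<tau> (X a) k)))"
      unfolding E_def \<tau>_def[symmetric] euler_eq_sum[of _ _ _ "Suc n"] by (simp add: X_def snd_sum del: sum.lessThan_Suc)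
    also have "\<bar>\<dots>\<bar> \<le> \<tau> * (\<Sum>k<Suc n. M)"
      unfolding abs_mult using assms(1)
      by (intro mult_mono order_trans[OF sum_abs] sum_mono) (auto simp: G_def M[OF ct] \<tau>_def)
    also have "\<dots> = M * T" by (simp add: \<tau>_def del: sum.lessThan_Suc of_nat_Suc)
    finally show ?thesis .
  qed
  have Ec: "continuous_on S (\<lambda>a. snd (E n a) - \<phi> (b * a))" for n S
  proof -
    have X: "continuous_on S X"
      unfolding X_def by (intro continuous_intros continuous_on_subset[OF \<psi>(1)]) auto
    show ?thesis unfolding E_def
      by (intro continuous_intros continuous_on_compose2[OF continuous_on_euler[OF Gc] X]
          continuous_on_compose2[OF \<psi>(1)]) auto
  qed
  have "\<exists>a. \<bar>a\<bar> \<le> R \<and> snd (E n a) = \<phi> (b * a)" for n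
  proof -
    \<comment> \<open>\<open>?D\<close> is the defect in \<open>u'(T) = b u'(0)\<close>. At
      \<open>?p\<close> the final \<open>z\<close> is at least 1 and \<open>\<phi> (b * ?p)\<close>
      is nonpositive; at \<open>?m\<close> the signs are reversed.\<close>
    let ?D = "\<lambda>a. snd (E n a) - \<phi> (b * a)"
    let ?p = "\<psi> (M * T + 1)" and ?m = "\<psi> (- (M * T + 1))"
    have pos: "M * T + 1 > 0" using M0 assms(1) by (simp add: add_nonneg_pos)
    note opp = opposite_signs[OF \<psi>(1) \<open>inj \<phi>\<close> assms(4,2)]
    have "\<phi> (b * ?p) \<le> 0" using opp[of ?p] pos by (simp add: \<psi>(4) mult_le_0_iff)
    then have Dp: "?D ?p \<ge> 0" using E_snd[of n ?p] by (simp add: \<psi>(4))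
    have "\<phi> (b * ?m) \<ge> 0" using opp[of ?m] pos by (simp add: \<psi>(4) mult_le_0_iff)
    then have Dm: "?D ?m \<le> 0" using E_snd[of n ?m] by (simp add: \<psi>(4))
    \<comment> \<open>Connectedness of the image is used because \<open>?p\<close> and
      \<open>?m\<close> come in either order: \<open>\<phi>\<close> may be decreasing.\<close>
    have "connected (?D ` {-R..R})" by (intro connected_continuous_image Ec) auto
    moreover have "?p \<in> {-R..R}" "?m \<in> {-R..R}" by (auto simp: R_def)
    ultimately have "0 \<in> ?D ` {-R..R}"
      using Dp Dm by (meson connectedD_interval imageI)
    then show ?thesis by (auto simp: abs_le_iff)
  qed
  then obtain A where A: "\<And>n. \<bar>A n\<bar> \<le> R" "\<And>n. snd (E n (A n)) = \<phi> (b * A n)" by metis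

  \<comment> \<open>Limit of the discrete solutions\<close>
  have XA: "norm (X (A n)) \<le> R + K" for n
  proof -
    have "norm (X (A n)) \<le> \<bar>A n\<bar> + \<bar>\<phi> (A n)\<bar>"
      by (simp add: X_def norm_Pair sqrt_sum_squares_le_sum_abs[THEN order_trans])
    then show ?thesis using A(1)[of n] K[OF A(1)[of n]] by simp
  qed
  obtain x and r :: "nat \<Rightarrow> nat" where der: "\<And>t. t \<in> {0..T} \<Longrightarrow> (x has_vector_derivative G t (x t)) (at t within {0..T})"
    and x0: "(\<lambda>n. X (A (r n))) \<longlonglongrightarrow> x 0"
    and xT: "(\<lambda>n. E (r n) (A (r n))) \<longlonglongrightarrow> x T"
    by (rule euler_subsequence_limit[OF assms(1) Gc GB, of "\<lambda>n. X (A n)", OF XA, folded E_def], rule that)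
  define u z where "u t = fst (x t)" and "z t = snd (x t)" for t
  have a_lim: "(\<lambda>n. A (r n)) \<longlonglongrightarrow> u 0"
    using tendsto_fst[OF x0] by (simp add: X_def u_def)
  \<comment> \<open>Used with \<open>c = 1\<close> at the initial time and \<open>c = b\<close> at
    the final time.\<close>
  have \<phi>_lim: "(\<lambda>n. \<phi> (c * A (r n))) \<longlonglongrightarrow> \<phi> (c * u 0)" for c
    by (rule continuous_on_tendsto_compose[OF \<psi>(1)]) (auto intro!: tendsto_intros a_lim)
  have z0: "z 0 = \<phi> (u 0)"
    using LIMSEQ_unique[OF tendsto_snd[OF x0]] \<phi>_lim[of 1] by (simp add: X_def z_def)
  have zT: "z T = \<phi> (b * u 0)"
    using LIMSEQ_unique[OF tendsto_snd[OF xT]] \<phi>_lim[of b] by (simp add: A(2) z_def)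
  have u0: "\<bar>u 0\<bar> \<le> R"
    by (rule tendsto_upperbound[OF tendsto_rabs[OF a_lim]]) (auto simp: A(1))
  have u': "(u has_real_derivative \<psi> (cz (z t))) (at t within {0..T})"
    and z': "(z has_real_derivative f t (u t) (\<psi> (cz (z t)))) (at t within {0..T})"
    if t: "t \<in> {0..T}" for t
  proof -
    have "ct t = t" using t by (simp add: ct_def)
    then have "(x has_derivative (\<lambda>s. s *\<^sub>R (\<psi> (cz (z t)), f t (u t) (\<psi> (cz (z t)))))) (at t within {0..T})"
      using der[OF t] by (simp add: has_vector_derivative_def G_def u_def z_def)
    from has_derivative_fst[OF this] has_derivative_snd[OF this]
    show "(u has_real_derivative \<psi> (cz (z t))) (at t within {0..T})"
      "(z has_real_derivative f t (u t) (\<psi> (cz (z t)))) (at t within {0..T})"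
      by (simp_all add: u_def[abs_def] z_def[abs_def] has_field_derivative_def mult_commute_abs)
  qed

  \<comment> \<open>Removal of the truncation\<close>
  have uc: "continuous_on {0..T} u" and zc: "continuous_on {0..T} z"
    using u' z' by (meson DERIV_continuous continuous_on_eq_continuous_within)+
  \<comment> \<open>The bound \<open>M\<close> on \<open>f\<close> holds for every argument, so even
    the clamped equation moves \<open>z\<close> by at most \<open>M * T\<close> from a value bounded
    by \<open>K\<close>. Hence the clamp is never active on \<open>{0..T}\<close>.\<close>
  have cz: "cz (z t) = z t" if t: "t \<in> {0..T}" for t
  proof -
    have "norm (z t - z 0) \<le> M * norm (t - 0)"
      by (rule field_differentiable_bound[OF _ z']) (use t assms(1) M in auto)
    also have "\<dots> \<le> M * T" using t M0 by (intro mult_left_mono) auto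
    finally have "\<bar>z t - z 0\<bar> \<le> M * T" by simp
    moreover have "\<bar>z 0\<bar> \<le> K" using K[OF u0] by (simp add: z0)
    ultimately show ?thesis by (auto simp: cz_def abs_le_iff)
  qed
  have \<psi>z: "continuous_on {0..T} (\<lambda>t. \<psi> (z t))"
    by (rule continuous_on_compose2[OF \<psi>(2) zc]) auto
  have "continuous_on {0..T} (\<lambda>t. (\<lambda>(t, x, y). f t x y) (t, u t, \<psi> (z t)))"
    by (intro continuous_on_compose2[OF assms(5)] continuous_intros uc \<psi>z) auto
  then have "C1_with_derivative T (\<lambda>t. \<phi> (\<psi> (z t))) (\<lambda>t. f t (u t) (\<psi> (z t)))"
    using z' cz by (simp add: C1_with_derivative_def \<psi>(4))
  moreover have "C1_with_derivative T u (\<lambda>t. \<psi> (z t))"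
    using u' cz \<psi>z by (simp add: C1_with_derivative_def)
  ultimately have "is_solution T b \<phi> f u"
    unfolding is_solution_def
    \<comment> \<open>Applying \<open>\<psi>\<close> to \<open>z0\<close> and \<open>zT\<close>
      turns them into the two boundary conditions.\<close>
    by (intro exI[of _ "\<lambda>t. \<psi> (z t)"] exI[of _ "\<lambda>t. f t (u t) (\<psi> (z t))"])
      (simp add: z0 zT \<psi>(3))
  then show ?thesis by blast
qed

end
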